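(* Suppose that $\Omega\subset\mathbb R^n$ is an open and convex set and that $\partial\Omega$ is piecewise smooth. Let $x_0\in\Omega$ and $\epsilon>0$ satisfy $\overline{B(x_0,\epsilon)}\subset\Omega$. Then there is $\rho\in C^\infty(\Omega)$ satisfying $\rho<0$ in $\Omega$, $|\nabla\rho|=1$ in $\Omega\setminus B(x_0,\epsilon)$, and $\partial_\nu\rho\le0$ on $\partial\Omega$.
   Context: $B(x_0,\epsilon)$ is the open Euclidean ball of radius $\epsilon$ centred at $x_0$. $\nu$ is the outward unit normal vector of $\partial\Omega$ (defined at the smooth points of the boundary), and $\partial_\nu\rho=\nu\cdot\nabla\rho$, where $\rho$ is understood to extend smoothly up to the boundary. *)

theory Defs
  imports "HOL-Analysis.Analysis"
begin

text \<open>Continuous differentiability of order \<open>k\<close>, meant for open \<open>S\<close>.\<close>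

primrec Ck_on :: "'a::euclidean_space set \<Rightarrow> nat \<Rightarrow> ('a \<Rightarrow> real) \<Rightarrow> bool" where
  "Ck_on S 0 f \<longleftrightarrow> continuous_on S f"
| "Ck_on S (Suc k) f \<longleftrightarrow>
     (\<forall>x\<in>S. f differentiable (at x)) \<and>
     (\<forall>v. Ck_on S k (\<lambda>x. frechet_derivative f (at x) v))"

definition smooth_on :: "'a::euclidean_space set \<Rightarrow> ('a \<Rightarrow> real) \<Rightarrow> bool" where
  "smooth_on S f \<longleftrightarrow> (\<forall>k. Ck_on S k f)"

text \<open>A HOL function is total, so the smooth extension of \<open>f\<close> beyond \<open>\<Omega>\<close> is \<open>f\<close> itself.
  The values and derivatives on the frontier are determined by those in \<open>\<Omega>\<close>.\<close>

definition smooth_up_to_boundary :: "'a::euclidean_space set \<Rightarrow> ('a \<Rightarrow> real) \<Rightarrow> bool" where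
  "smooth_up_to_boundary \<Omega> f \<longleftrightarrow> (\<exists>V. open V \<and> closure \<Omega> \<subseteq> V \<and> smooth_on V f)"

definition grad :: "('a::euclidean_space \<Rightarrow> real) \<Rightarrow> 'a \<Rightarrow> 'a" where
  "grad f x = (THE D. GDERIV f x :> D)"

definition local_defining_function ::
    "'a::euclidean_space set \<Rightarrow> 'a set \<Rightarrow> ('a \<Rightarrow> real) \<Rightarrow> bool" where
  "local_defining_function \<Omega> U \<phi> \<longleftrightarrow>
     open U \<and> smooth_on U \<phi> \<and> (\<forall>x\<in>U. grad \<phi> x \<noteq> 0) \<and> \<Omega> \<inter> U = {x\<in>U. \<phi> x < 0}"

definition smooth_boundary_points :: "'a::euclidean_space set \<Rightarrow> 'a set" where
  "smooth_boundary_points \<Omega> =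
     {y \<in> frontier \<Omega>. \<exists>U \<phi>. y \<in> U \<and> local_defining_function \<Omega> U \<phi>}"

text \<open>The vector \<open>\<nu>\<close> does not depend on the choice of the defining function, and it exists
  exactly at the smooth boundary points.\<close>

definition outward_unit_normal :: "'a::euclidean_space set \<Rightarrow> 'a \<Rightarrow> 'a \<Rightarrow> bool" where
  "outward_unit_normal \<Omega> y \<nu> \<longleftrightarrow>
     y \<in> frontier \<Omega> \<and>
     (\<exists>U \<phi>. y \<in> U \<and> local_defining_function \<Omega> U \<phi> \<and>
            \<nu> = grad \<phi> y /\<^sub>R norm (grad \<phi> y))"

text \<open>Vanishing \<open>d\<close>-dimensional Hausdorff measure. The covering family may be finite or empty,
  so for \<open>d = 0\<close> only the empty set is null.\<close>

definition hausdorff_null :: "nat \<Rightarrow> 'a::euclidean_space set \<Rightarrow> bool" where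
  "hausdorff_null d E \<longleftrightarrow>
     (\<forall>e>0. \<exists>C :: ('a \<times> real) set. countable C \<and> (\<forall>(c, r)\<in>C. 0 < r) \<and>
        E \<subseteq> (\<Union>(c, r)\<in>C. ball c r) \<and>
        (\<lambda>(c, r). r ^ d) summable_on C \<and> (\<Sum>\<^sub>\<infinity>(c, r)\<in>C. r ^ d) < e)"

text \<open>The boundary is made up of the closures of smooth connected hypersurface pieces, finitely
  many near each boundary point, and the edges left over by the pieces have codimension-one
  measure zero. The pieces need not be smooth up to their own edges, so that for instance conical
  points are allowed. Without connectedness the finiteness condition would be empty.\<close>

definition piecewise_smooth_boundary :: "'a::euclidean_space set \<Rightarrow> bool" where
  "piecewise_smooth_boundary \<Omega> \<longleftrightarrow>
     (\<exists>\<S>. (\<forall>\<Gamma>\<in>\<S>. connected \<Gamma> \<and> openin (top_of_set (frontier \<Omega>)) \<Gamma> \<and>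
                   \<Gamma> \<subseteq> smooth_boundary_points \<Omega>) \<and>
          locally_finite_in (top_of_set (frontier \<Omega>)) \<S> \<and>
          frontier \<Omega> = (\<Union>\<Gamma>\<in>\<S>. closure \<Gamma>) \<and>
          hausdorff_null (DIM('a) - 1) (frontier \<Omega> - \<Union>\<S>))"

end

theory Submission
  imports Defs
begin

text \<open>Take \<open>\<rho> x = - sqrt (u x)\<close> with \<open>u x = s + flat 0 (\<epsilon>\<^sup>2 - s)\<close>, \<open>s = |x - x\<^sub>0|\<^sup>2\<close>, where
  \<open>flat 0 t = exp (- 1 / t)\<close> for \<open>t > 0\<close> and \<open>flat 0 t = 0\<close> otherwise. Then \<open>u > 0\<close> everywhere, so
  \<open>\<rho>\<close> is negative and smooth on the whole space, and off the ball \<open>\<rho>\<close> is minus the distance to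
  \<open>x\<^sub>0\<close>. By convexity the segment from a boundary point \<open>y\<close> to \<open>x\<^sub>0\<close> enters \<open>\<Omega>\<close> at once, so a defining
  function does not increase in the direction \<open>x\<^sub>0 - y\<close>, which is that of \<open>grad \<rho> y\<close>.
  Smoothness holds because \<open>\<rho>\<close> lies in an algebra of functions closed under directional
  derivatives.\<close>

section \<open>Smoothness criterion and gradients\<close>

text \<open>Induction on the order, with the function left arbitrary: each directional derivative is
  again in \<open>A\<close>, and differentiability gives the continuity at order 0.\<close>

lemma smooth_on_if_closed_under_derivatives:
  assumes "f \<in> A"
    and diff: "\<And>f x. f \<in> A \<Longrightarrow> x \<in> S \<Longrightarrow> f differentiable (at x)"
    and deriv: "\<And>f v. f \<in> A \<Longrightarrow> (\<lambda>x. frechet_derivative f (at x) v) \<in> A"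
  shows "smooth_on S f"
proof -
  have "Ck_on S k f" if "f \<in> A" for k f
    using that
  proof (induction k arbitrary: f)
    case 0
    then show ?case
      using diff by (simp add: continuous_at_imp_continuous_on differentiable_imp_continuous_within)
  next
    case (Suc k)
    then show ?case using diff deriv by simp
  qed
  with \<open>f \<in> A\<close> show ?thesis by (simp add: smooth_on_def)
qed

lemma grad_eqI:
  assumes "GDERIV f x :> D"
  shows "grad f x = D"
  unfolding grad_def
proof (rule the_equality, rule assms)
  fix E assume "GDERIV f x :> E"
  with assms have "(\<lambda>h. h \<bullet> E) = (\<lambda>h. h \<bullet> D)"
    unfolding gderiv_def by (rule has_derivative_unique[rotated])
  then show "E = D" by (simp add: fun_eq_iff vector_eq_ldot)
qed

text \<open>Collecting the values of the derivative on the basis gives the vector that represents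
  it, so the description operator in \<open>grad\<close> is well defined.\<close>

lemma GDERIV_grad:
  assumes "f differentiable (at x)"
  shows "GDERIV f x :> grad f x"
proof -
  obtain f' where f': "(f has_derivative f') (at x)"
    using assms by (auto simp: differentiable_def)
  interpret linear f' using f' by (rule has_derivative_linear)
  have "(\<Sum>i\<in>Basis. f' i *\<^sub>R i) \<bullet> h = f' h" for h
  proof -
    have "f' h = f' (\<Sum>i\<in>Basis. (h \<bullet> i) *\<^sub>R i)" by (simp add: euclidean_representation)
    also have "\<dots> = (\<Sum>i\<in>Basis. (h \<bullet> i) * f' i)" by (simp add: sum scaleR)
    finally show ?thesis by (simp add: inner_sum_left inner_commute[of h] mult.commute)
  qed
  then have "GDERIV f x :> (\<Sum>i\<in>Basis. f' i *\<^sub>R i)"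
    using f' by (simp add: gderiv_def inner_commute)
  then show ?thesis by (simp add: grad_eqI)
qed

section \<open>The flat function exp(-1/t) and its derivatives\<close>

text \<open>The powers of \<open>t\<close> in the denominator make the linear span of the family
  closed under differentiation.\<close>

definition flat :: "nat \<Rightarrow> real \<Rightarrow> real" where
  "flat k t = (if t > 0 then exp (- 1 / t) / t ^ k else 0)"

lemma flat_tendsto_0: "(flat k \<longlongrightarrow> 0) (at_right 0)"
proof -
  have "((\<lambda>t. inverse t ^ k / exp (inverse t)) \<longlongrightarrow> (0::real)) (at_right 0)"
    using tendsto_power_div_exp_0 filterlim_inverse_at_top_right by (rule filterlim_compose)
  moreover have "\<forall>\<^sub>F t in at_right 0. inverse t ^ k / exp (inverse t) = flat k t"
    using eventually_at_right_less[of 0]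
    by eventually_elim (simp add: flat_def exp_minus field_simps)
  ultimately show ?thesis by (rule Lim_transform_eventually)
qed

lemma has_real_derivative_flat:
  "(flat k has_real_derivative flat (k + 2) t - real k * flat (k + 1) t) (at t)"
proof (cases t "0::real" rule: linorder_cases)
  case less
  have "((\<lambda>_. 0) has_real_derivative 0) (at t)" by simp
  then have "(flat k has_real_derivative 0) (at t)"
    by (rule has_field_derivative_transform_within_open[where S = "{..<0}"])
       (use less in \<open>auto simp: flat_def\<close>)
  with less show ?thesis by (simp add: flat_def)
next
  case equal
  \<comment> \<open>For h > 0 the difference quotient at 0 is \<open>flat (k + 1) h\<close>; for h <
    0 it is 0.\<close>
  have "((\<lambda>h. flat k h / h) \<longlongrightarrow> 0) (at_right 0)"
    by (rule Lim_transform_eventually[OF flat_tendsto_0[of "k + 1"]])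
       (use eventually_at_right_less[of 0] in eventually_elim, simp add: flat_def)
  moreover have "((\<lambda>h. flat k h / h) \<longlongrightarrow> 0) (at_left 0)"
    by (rule tendsto_eventually)
       (use eventually_at_left_real[of "-1" 0] in \<open>simp add: eventually_mono flat_def\<close>)
  ultimately have "((\<lambda>h. flat k h / h) \<longlongrightarrow> 0) (at 0)"
    by (simp add: filterlim_split_at)
  with equal show ?thesis by (simp add: DERIV_def flat_def)
next
  case greater
  have "((\<lambda>t. exp (- 1 / t) / t ^ k) has_real_derivative
      (exp (- 1 / t) * (1 / t\<^sup>2) * t ^ k - exp (- 1 / t) * (real k * t ^ (k - 1))) / (t ^ k * t ^ k))
      (at t)"
    using greater
    by (auto intro!: derivative_eq_intros simp: power2_eq_square)
  also have "(exp (- 1 / t) * (1 / t\<^sup>2) * t ^ k - exp (- 1 / t) * (real k * t ^ (k - 1))) / (t ^ k * t ^ k)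
      = flat (k + 2) t - real k * flat (k + 1) t"
    \<comment> \<open>The case split handles the truncated exponent \<open>k - 1\<close>: for k = 0
      its term carries the factor 0.\<close>
    using greater by (cases k) (simp_all add: flat_def field_simps power2_eq_square)
  finally have "((\<lambda>t. exp (- 1 / t) / t ^ k) has_real_derivative
      flat (k + 2) t - real k * flat (k + 1) t) (at t)" .
  then show ?thesis
    by (rule has_field_derivative_transform_within_open[where S = "{0<..}"])
       (use greater in \<open>auto simp: flat_def\<close>)
qed

section \<open>Defining functions of a convex set along inward segments\<close>

lemma inner_gradient_le_0:
  fixes y z :: "'a::euclidean_space"
  assumes "open \<Omega>" "convex \<Omega>" "z \<in> \<Omega>" "y \<in> frontier \<Omega>"
    and U: "local_defining_function \<Omega> U \<phi>" "y \<in> U"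
  shows "grad \<phi> y \<bullet> (z - y) \<le> 0"
proof -
  have smooth: "smooth_on U \<phi>" and "open U" and \<Omega>U: "\<Omega> \<inter> U = {x \<in> U. \<phi> x < 0}"
    using U(1) by (auto simp: local_defining_function_def)
  from smooth have "Ck_on U (Suc 0) \<phi>" unfolding smooth_on_def by blast
  with U(2) have "GDERIV \<phi> y :> grad \<phi> y" by (intro GDERIV_grad) auto
  \<comment> \<open>The base point is written as the value at t = 0 of the segment, to match the
    chain rule.\<close>
  then have "(\<phi> has_derivative (\<lambda>h. h \<bullet> grad \<phi> y)) (at (y + 0 *\<^sub>R (z - y)))"
    by (simp add: gderiv_def)
  then have "((\<lambda>t. \<phi> (y + t *\<^sub>R (z - y))) has_derivative (\<lambda>t. (t *\<^sub>R (z - y)) \<bullet> grad \<phi> y)) (at 0)"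
    by (rule has_derivative_compose[rotated]) (auto intro!: derivative_eq_intros)
  then have D: "((\<lambda>t. \<phi> (y + t *\<^sub>R (z - y))) has_real_derivative grad \<phi> y \<bullet> (z - y)) (at 0)"
    by (simp add: has_field_derivative_def inner_commute mult.commute[of _ "_ \<bullet> _"])
  show ?thesis
  proof (rule ccontr)
    assume "\<not> ?thesis"
    with DERIV_pos_inc_right[OF D] obtain d where d: "d > 0"
      "\<And>h. 0 < h \<Longrightarrow> h < d \<Longrightarrow> \<phi> y < \<phi> (y + h *\<^sub>R (z - y))"
      by auto
    have "((\<lambda>t. y + t *\<^sub>R (z - y)) \<longlongrightarrow> y + 0 *\<^sub>R (z - y)) (at_right 0)"
      by (intro tendsto_intros)
    with \<open>open U\<close> U(2) have "\<forall>\<^sub>F t in at_right 0. y + t *\<^sub>R (z - y) \<in> U"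
      by (simp add: tendsto_def)
    moreover have "\<forall>\<^sub>F t in at_right 0. t \<in> {0<..<min d 1}"
      using d(1) by (intro eventually_at_right_real) simp
    ultimately have "\<forall>\<^sub>F t in at_right (0::real). y + t *\<^sub>R (z - y) \<in> U \<and> t \<in> {0<..<min d 1}"
      by eventually_elim simp
    then obtain t where t: "y + t *\<^sub>R (z - y) \<in> U" "0 < t" "t < d" "t < 1"
      using eventually_happens'[OF trivial_limit_at_right_real] by fastforce
    have "y \<in> closure \<Omega>" "y \<notin> \<Omega>"
      using assms(1,4) by (auto simp: frontier_def interior_open)
    \<comment> \<open>In a convex set, points strictly between a closure point and an interior point
      are interior.\<close>
    then have "y - t *\<^sub>R (y - z) \<in> interior \<Omega>"
      using mem_interior_closure_convex_shrink[of \<Omega> z y t] assms(1-3) t by (simp add: interior_open)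
    then have "y + t *\<^sub>R (z - y) \<in> \<Omega>"
      using assms(1) by (simp add: interior_open algebra_simps)
    with t(1) \<Omega>U have "\<phi> (y + t *\<^sub>R (z - y)) < 0" by blast
    \<comment> \<open>A positive slope at \<open>y\<close> puts \<phi> y below a negative value,
      which would place \<open>y\<close> in \<Omega>.\<close>
    with d(2)[OF t(2,3)] have "\<phi> y < 0" by simp
    with \<Omega>U U(2) \<open>y \<notin> \<Omega>\<close> show False by blast
  qed
qed

section \<open>The regularized distance and its smoothness\<close>

locale regularized_distance =
  fixes c :: "'a::euclidean_space" and r :: real
  assumes r_pos: "r > 0"
begin

definition s :: "'a \<Rightarrow> real" where "s x = (x - c) \<bullet> (x - c)"

definition u :: "'a \<Rightarrow> real" where "u x = s x + flat 0 (r\<^sup>2 - s x)"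

definition \<rho> :: "'a \<Rightarrow> real" where "\<rho> x = - sqrt (u x)"

text \<open>The reciprocal \<open>1 / sqrt (u x)\<close> is the generator rather than \<open>sqrt (u x)\<close>: its derivative
  is polynomial in the generators.\<close>

inductive_set alg :: "('a \<Rightarrow> real) set" where
  const: "(\<lambda>_. a) \<in> alg"
| inner: "(\<lambda>x. (x - c) \<bullet> v) \<in> alg"
| s: "s \<in> alg"
| flat: "(\<lambda>x. flat k (r\<^sup>2 - s x)) \<in> alg"
| inverse_sqrt: "(\<lambda>x. inverse (sqrt (u x))) \<in> alg"
| add: "f \<in> alg \<Longrightarrow> g \<in> alg \<Longrightarrow> (\<lambda>x. f x + g x) \<in> alg"
| mult: "f \<in> alg \<Longrightarrow> g \<in> alg \<Longrightarrow> (\<lambda>x. f x * g x) \<in> alg"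

text \<open>Off \<open>c\<close> the term \<open>s x\<close> is positive; at \<open>c\<close> it
  vanishes, but the flat term is exp(-1/r^2).\<close>

lemma u_pos: "u x > 0"
proof (cases "x = c")
  case True
  with r_pos show ?thesis by (simp add: u_def s_def flat_def)
next
  case False
  then show ?thesis by (simp add: u_def s_def flat_def add_pos_nonneg)
qed

lemma s_has_derivative: "(s has_derivative (\<lambda>h. 2 * ((x - c) \<bullet> h))) (at x)"
  unfolding s_def by (auto intro!: derivative_eq_intros simp: inner_commute)

lemma flat_s_has_derivative:
  "((\<lambda>x. flat k (r\<^sup>2 - s x)) has_derivative
    (\<lambda>h. (flat (k + 2) (r\<^sup>2 - s x) - real k * flat (k + 1) (r\<^sup>2 - s x)) * (-2 * ((x - c) \<bullet> h)))) (at x)"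
proof -
  have "((\<lambda>x. r\<^sup>2 - s x) has_derivative (\<lambda>h. -2 * ((x - c) \<bullet> h))) (at x)"
    by (auto intro!: derivative_eq_intros s_has_derivative)
  from has_derivative_compose[OF this has_real_derivative_flat[unfolded has_field_derivative_def]]
  show ?thesis .
qed

text \<open>The derivative of \<open>flat 0\<close> is \<open>flat 2\<close> alone, and the inner
  function contributes the minus sign.\<close>

lemma u_has_derivative:
  "(u has_derivative (\<lambda>h. (2 - 2 * flat 2 (r\<^sup>2 - s x)) * ((x - c) \<bullet> h))) (at x)"
  unfolding u_def[abs_def]
  by (rule derivative_eq_intros s_has_derivative flat_s_has_derivative)+
     (simp add: algebra_simps flip: numeral_2_eq_2)

text \<open>The direction is the first argument of \<open>f'\<close>, so that \<open>f' h\<close> is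
  a function of the point and can be a member of \<open>alg\<close>.\<close>

lemma alg_derivative:
  assumes "f \<in> alg"
  shows "\<exists>f'. (\<forall>x. (f has_derivative (\<lambda>h. f' h x)) (at x)) \<and> (\<forall>h. f' h \<in> alg)"
  using assms
proof induction
  case (const a)
  show ?case by (intro exI[of _ "\<lambda>_ _. 0"]) (auto intro: alg.const)
next
  case (inner v)
  show ?case
    by (intro exI[of _ "\<lambda>h _. h \<bullet> v"]) (auto intro!: derivative_eq_intros alg.const)
next
  case s
  show ?case
    by (intro exI[of _ "\<lambda>h x. 2 * ((x - c) \<bullet> h)"])
       (auto intro!: s_has_derivative alg.intros)
next
  case (flat k)
  \<comment> \<open>\<open>alg\<close> has sums and products only, so the difference is written with
    the constant \<open>- real k\<close>.\<close>
  have "(\<lambda>x. (flat (k + 2) (r\<^sup>2 - s x) + (- real k) * flat (k + 1) (r\<^sup>2 - s x))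
      * (-2 * ((x - c) \<bullet> h))) \<in> alg" for h
    by (intro alg.intros)
  then show ?case
    using flat_s_has_derivative[of k]
    by (intro exI[of _ "\<lambda>h x. (flat (k + 2) (r\<^sup>2 - s x) - real k * flat (k + 1) (r\<^sup>2 - s x))
      * (-2 * ((x - c) \<bullet> h))"]) simp
next
  case inverse_sqrt
  let ?w = "\<lambda>x. inverse (sqrt (u x))"
  \<comment> \<open>The derivative of t^(-1/2) is -1/2 times its cube; the factor -1/2 is absorbed
    into \<open>2 - 2 * flat 2 _\<close>.\<close>
  define f' where "f' h x =
    (-1 + 1 * flat 2 (r\<^sup>2 - s x)) * (((x - c) \<bullet> h) * (?w x * (?w x * ?w x)))" for h x
  have "((\<lambda>t. inverse (sqrt t)) has_real_derivative - (?w x * (?w x * ?w x)) / 2) (at (u x))" for x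
    using u_pos[of x]
    by (auto intro!: derivative_eq_intros simp: field_simps power2_eq_square)
  from has_derivative_compose[OF u_has_derivative this[unfolded has_field_derivative_def]]
  have "(?w has_derivative (\<lambda>h. f' h x)) (at x)" for x
    by (rule has_derivative_eq_rhs) (simp add: f'_def fun_eq_iff algebra_simps)
  moreover have "f' h \<in> alg" for h
    unfolding f'_def by (intro alg.intros)
  ultimately show ?case by blast
next
  case (add f g)
  then obtain f' g' where
    "\<And>x. (f has_derivative (\<lambda>h. f' h x)) (at x)" "\<And>h. f' h \<in> alg"
    "\<And>x. (g has_derivative (\<lambda>h. g' h x)) (at x)" "\<And>h. g' h \<in> alg" by blast
  then show ?case
    by (intro exI[of _ "\<lambda>h x. f' h x + g' h x"])
       (auto intro!: has_derivative_add alg.add)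
next
  case (mult f g)
  then obtain f' g' where
    "\<And>x. (f has_derivative (\<lambda>h. f' h x)) (at x)" "\<And>h. f' h \<in> alg"
    "\<And>x. (g has_derivative (\<lambda>h. g' h x)) (at x)" "\<And>h. g' h \<in> alg" by blast
  with mult.hyps show ?case
    by (intro exI[of _ "\<lambda>h x. f x * g' h x + f' h x * g x"])
       (auto intro!: has_derivative_mult alg.add alg.mult)
qed

lemma smooth_on_alg:
  assumes "f \<in> alg"
  shows "smooth_on S f"
proof (rule smooth_on_if_closed_under_derivatives[OF assms])
  fix f :: "'a \<Rightarrow> real" assume "f \<in> alg"
  from alg_derivative[OF this] obtain f' where
    f': "\<And>x. (f has_derivative (\<lambda>h. f' h x)) (at x)" "\<And>h. f' h \<in> alg" by blast
  show "f differentiable (at x)" for x using f'(1) by (auto simp: differentiable_def)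
  show "(\<lambda>x. frechet_derivative f (at x) v) \<in> alg" for v
  proof -
    have "frechet_derivative f (at x) v = f' v x" for x
      using fun_cong[OF frechet_derivative_at[OF f'(1)[of x]], of v] by (rule sym)
    then have "(\<lambda>x. frechet_derivative f (at x) v) = f' v" by (rule ext)
    with f'(2) show ?thesis by metis
  qed
qed

lemma smooth_on_\<rho>: "smooth_on S \<rho>"
proof -
  \<comment> \<open>Writing sqrt u as u times 1 / sqrt u expresses \<rho> in the generators.\<close>
  have "\<rho> = (\<lambda>x. (-1 * (s x + flat 0 (r\<^sup>2 - s x))) * inverse (sqrt (u x)))"
    using u_pos by (auto simp: fun_eq_iff \<rho>_def real_div_sqrt less_imp_le simp flip: u_def divide_inverse)
  also have "\<dots> \<in> alg" by (intro alg.intros)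
  finally show ?thesis by (rule smooth_on_alg)
qed

text \<open>The derivative formula holds everywhere, so it is evaluated at the single point
  \<open>x\<close>, where all flat terms vanish. This covers the sphere too, around which \<rho> is
  minus the distance on the outer side only.\<close>

lemma grad_\<rho>:
  assumes "dist c x \<ge> r"
  shows "grad \<rho> x = - ((x - c) /\<^sub>R norm (x - c))"
proof (rule grad_eqI)
  have s: "s x = (norm (x - c))\<^sup>2" by (simp add: s_def power2_norm_eq_inner)
  have "norm (x - c) \<ge> r" using assms by (simp add: dist_norm norm_minus_commute)
  then have "s x \<ge> r\<^sup>2" using r_pos by (simp add: s)
  then have flat: "flat k (r\<^sup>2 - s x) = 0" for k by (simp add: flat_def)
  then have "u x = (norm (x - c))\<^sup>2" by (simp add: u_def s)
  then have sqrt_u: "sqrt (u x) = norm (x - c)" by simp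
  have "(\<rho> has_derivative (\<lambda>h. - (((2 - 2 * flat 2 (r\<^sup>2 - s x)) * ((x - c) \<bullet> h)) *
      (inverse (sqrt (u x)) / 2)))) (at x)"
    unfolding \<rho>_def
    by (rule derivative_eq_intros u_has_derivative u_pos)+ (auto simp: algebra_simps)
  then show "GDERIV \<rho> x :> - ((x - c) /\<^sub>R norm (x - c))"
    unfolding gderiv_def
    by (rule has_derivative_eq_rhs) (simp add: fun_eq_iff flat sqrt_u inner_commute)
qed

end

theorem lemma7:
  fixes \<Omega> :: "(real ^ 'n) set" and x\<^sub>0 :: "real ^ 'n" and \<epsilon> :: real
  assumes "open \<Omega>" and "convex \<Omega>" and "piecewise_smooth_boundary \<Omega>"
    and "x\<^sub>0 \<in> \<Omega>" and "\<epsilon> > 0" and "closure (ball x\<^sub>0 \<epsilon>) \<subseteq> \<Omega>"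
  shows "\<exists>\<rho> :: real ^ 'n \<Rightarrow> real.
           smooth_on \<Omega> \<rho> \<and> smooth_up_to_boundary \<Omega> \<rho> \<and>
           (\<forall>x\<in>\<Omega>. \<rho> x < 0) \<and>
           (\<forall>x\<in>\<Omega> - ball x\<^sub>0 \<epsilon>. norm (grad \<rho> x) = 1) \<and>
           (\<forall>y\<in>frontier \<Omega>. \<forall>\<nu>. outward_unit_normal \<Omega> y \<nu> \<longrightarrow> \<nu> \<bullet> grad \<rho> y \<le> 0)"
proof -
  interpret regularized_distance x\<^sub>0 \<epsilon> using \<open>\<epsilon> > 0\<close> by unfold_locales
  show ?thesis
  proof (intro exI[of _ \<rho>] conjI ballI allI impI)
    show "smooth_on \<Omega> \<rho>" by (rule smooth_on_\<rho>)
    show "smooth_up_to_boundary \<Omega> \<rho>"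
      \<comment> \<open>Smoothness holds on every set, so the whole space can serve as the
        neighbourhood of the closure.\<close>
      unfolding smooth_up_to_boundary_def using smooth_on_\<rho> by blast
    show "\<rho> x < 0" for x using u_pos by (simp add: \<rho>_def)
    show "norm (grad \<rho> x) = 1" if "x \<in> \<Omega> - ball x\<^sub>0 \<epsilon>" for x
    proof -
      from that have "dist x\<^sub>0 x \<ge> \<epsilon>" by simp
      moreover from this \<open>\<epsilon> > 0\<close> have "x \<noteq> x\<^sub>0" by auto
      ultimately show ?thesis by (simp add: grad_\<rho>)
    qed
  next
    fix y \<nu> assume y: "y \<in> frontier \<Omega>" and "outward_unit_normal \<Omega> y \<nu>"
    then obtain U \<phi> where U: "y \<in> U" "local_defining_function \<Omega> U \<phi>"
      and \<nu>: "\<nu> = grad \<phi> y /\<^sub>R norm (grad \<phi> y)"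
      by (auto simp: outward_unit_normal_def)
    have "y \<notin> \<Omega>" using y \<open>open \<Omega>\<close> by (simp add: frontier_def interior_open)
    then have "y \<notin> ball x\<^sub>0 \<epsilon>" using assms(6) closure_subset by blast
    \<comment> \<open>Outside the ball, \<open>grad \<rho> y\<close> is the unit vector from
      \<open>y\<close> towards the centre, so the sign is that of the derivative of \<phi> in this
      direction.\<close>
    then have "\<nu> \<bullet> grad \<rho> y =
        (grad \<phi> y \<bullet> (x\<^sub>0 - y)) * (inverse (norm (grad \<phi> y)) * inverse (norm (y - x\<^sub>0)))"
      by (simp add: \<nu> grad_\<rho> inner_diff_right algebra_simps)
    also have "\<dots> \<le> 0"
      using inner_gradient_le_0[OF assms(1,2,4) y U(2,1)] by (intro mult_nonpos_nonneg) auto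
    finally show "\<nu> \<bullet> grad \<rho> y \<le> 0" .
  qed
qed

end
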